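(* Let $\mathbf{d}=(d_1,\dots,d_n)$ be a graphical sequence. Then $\mathbf{d}$ admits a realization (a simple graph) containing two spanning trees that share at most one edge if and only if $\sum_{i=1}^n d_i\ge 4(n-1)-2$ and either (a) $n\le 2$, or (b) $n>2$, $d_{n-1}\ge 2$ and $d_n\ge 1$.
   Context: A degree sequence is non-increasing, $d_1\ge\dots\ge d_n\ge 0$; it is graphical if some simple graph on vertices $v_1,\dots,v_n$ has $\deg(v_i)=d_i$ (a realization). Two spanning trees share at most one edge if their edge sets have at most one common element. *)

theory Defs
  imports Main
begin

(* A graph is given by a vertex set V and a set E of two-element subsets of V.
   The notion of tree in AFP Graph_Theory is not used: cycles there are directed,
   so a symmetric digraph with an arc is never a tree, while an acyclic orientation of an
   undirected cycle can be one. *)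

definition simple_graph :: "'a set \<Rightarrow> 'a set set \<Rightarrow> bool" where
  "simple_graph V E \<longleftrightarrow> finite V \<and> (\<forall>e\<in>E. e \<subseteq> V \<and> card e = 2)"

definition degree :: "'a set set \<Rightarrow> 'a \<Rightarrow> nat" where
  "degree E v = card {e \<in> E. v \<in> e}"

definition graph_connected :: "'a set \<Rightarrow> 'a set set \<Rightarrow> bool" where
  "graph_connected V E \<longleftrightarrow>
     V \<noteq> {} \<and> (\<forall>u\<in>V. \<forall>v\<in>V. (u, v) \<in> {(x, y). {x, y} \<in> E}\<^sup>*)"

definition is_cycle :: "'a set set \<Rightarrow> 'a list \<Rightarrow> bool" where
  "is_cycle E xs \<longleftrightarrow> length xs \<ge> 3 \<and> distinct xs \<and>
     (\<forall>i<length xs. {xs ! i, xs ! (Suc i mod length xs)} \<in> E)"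

definition is_tree :: "'a set \<Rightarrow> 'a set set \<Rightarrow> bool" where
  "is_tree V T \<longleftrightarrow> simple_graph V T \<and> graph_connected V T \<and> (\<nexists>xs. is_cycle T xs)"

definition spanning_tree :: "'a set \<Rightarrow> 'a set set \<Rightarrow> 'a set set \<Rightarrow> bool" where
  "spanning_tree V E T \<longleftrightarrow> T \<subseteq> E \<and> is_tree V T"

(* A sequence (d_1, ..., d_n) is a function d of which only the values on {1..n} matter;
   the vertex v_i is the number i. *)

definition degree_sequence :: "nat \<Rightarrow> (nat \<Rightarrow> nat) \<Rightarrow> bool" where
  "degree_sequence n d \<longleftrightarrow> (\<forall>i\<in>{1..n}. \<forall>j\<in>{1..n}. i \<le> j \<longrightarrow> d i \<ge> d j)"

definition realization :: "nat \<Rightarrow> (nat \<Rightarrow> nat) \<Rightarrow> nat set set \<Rightarrow> bool" where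
  "realization n d E \<longleftrightarrow> simple_graph {1..n} E \<and> (\<forall>i\<in>{1..n}. degree E i = d i)"

definition graphical :: "nat \<Rightarrow> (nat \<Rightarrow> nat) \<Rightarrow> bool" where
  "graphical n d \<longleftrightarrow> degree_sequence n d \<and> (\<exists>E. realization n d E)"

end

theory Submission
  imports Defs
begin

text \<open>
  Necessity: two connected spanning subgraphs sharing at most one edge have at least
  \<open>2(n-1) - 1\<close> edges in total, and the edge at a vertex of degree one lies in both of them.

  Sufficiency is proved together with its analogue for edge-disjoint trees (all degrees at least
  two and degree sum at least \<open>4(n-1)\<close>), by induction on the number of vertices, removing a vertex
  \<open>v\<close> of minimum degree. If \<open>v\<close> has degree one, a Havel-Hakimi switch makes its neighbour have degree
  at least three, and the rest falls under the edge-disjoint case. If \<open>v\<close> has degree two, switching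
  again keeps the degree conditions after deletion of \<open>v\<close>. If its degree is at least four, or three with
  edges to spare, \<open>v\<close> is just deleted. In the remaining case \<open>v\<close> has degree three and the degree
  sum is as small as allowed. Then, unless the graph is \<open>K\<^sub>4\<close>, there is a graph on the other
  vertices in which only one vertex \<open>c\<close> has changed its degree, by minus one; \<open>v\<close> is put back by subdividing
  an edge of that graph that avoids \<open>c\<close> and joining \<open>v\<close> to \<open>c\<close>.
\<close>

subsection \<open>Degrees and neighbourhoods\<close>

text \<open>The counterpart of \<open>realization\<close> for an arbitrary vertex set and unsorted
  degrees: the inductions delete vertices, after which neither \<open>{1..n}\<close> nor the order
  of the degrees survives.\<close>

definition realizes :: "'a set \<Rightarrow> ('a \<Rightarrow> nat) \<Rightarrow> 'a set set \<Rightarrow> bool" where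
  "realizes V d E \<longleftrightarrow> simple_graph V E \<and> (\<forall>v\<in>V. degree E v = d v)"

definition nbrs :: "'a set set \<Rightarrow> 'a \<Rightarrow> 'a set" where
  "nbrs E v = {u. {v, u} \<in> E}"

definition delete_vertex :: "'a set set \<Rightarrow> 'a \<Rightarrow> 'a set set" where
  "delete_vertex E v = {e \<in> E. v \<notin> e}"

lemma simple_graph_finite:
  assumes "simple_graph V E" shows "finite E"
proof -
  have "E \<subseteq> Pow V" "finite (Pow V)" using assms unfolding simple_graph_def by auto
  then show ?thesis by (rule finite_subset)
qed

lemma simple_graph_edgeD:
  assumes "simple_graph V E" "{x, y} \<in> E"
  shows "x \<in> V" "y \<in> V" "x \<noteq> y"
proof -
  have "{x, y} \<subseteq> V" "card {x, y} = 2" using assms unfolding simple_graph_def by blast+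
  then show "x \<in> V" "y \<in> V" "x \<noteq> y" by auto
qed

lemma simple_graph_edgeE:
  assumes "simple_graph V E" "e \<in> E"
  obtains x y where "e = {x, y}" "x \<noteq> y" "x \<in> V" "y \<in> V"
proof -
  have "card e = 2" "e \<subseteq> V" using assms unfolding simple_graph_def by auto
  then show ?thesis using that by (auto simp: card_2_iff)
qed

lemma simple_graph_edgeE':
  assumes "simple_graph V E" "e \<in> E" "v \<in> e"
  obtains u where "e = {v, u}" "u \<noteq> v" "u \<in> V"
proof -
  obtain x y where "e = {x, y}" "x \<noteq> y" "x \<in> V" "y \<in> V"
    using simple_graph_edgeE[OF assms(1,2)] by blast
  then show ?thesis using assms(3) that[of x] that[of y] by (auto simp: insert_commute)
qed

lemma simple_graph_insert:
  "simple_graph V E \<Longrightarrow> x \<in> V \<Longrightarrow> y \<in> V \<Longrightarrow> x \<noteq> y \<Longrightarrow> simple_graph V (insert {x, y} E)"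
  unfolding simple_graph_def by auto

lemma simple_graph_subset:
  "simple_graph V E \<Longrightarrow> F \<subseteq> E \<Longrightarrow> simple_graph V F"
  unfolding simple_graph_def by auto

lemma nbrs_sub: "simple_graph V E \<Longrightarrow> nbrs E v \<subseteq> V - {v}"
  unfolding nbrs_def by (auto dest: simple_graph_edgeD)

lemma nbrs_sym: "u \<in> nbrs E v \<longleftrightarrow> v \<in> nbrs E u"
  unfolding nbrs_def by (simp add: insert_commute)

lemma degree_eq_card_nbrs:
  assumes "simple_graph V E"
  shows "degree E v = card (nbrs E v)"
proof -
  have "bij_betw (\<lambda>u. {v, u}) (nbrs E v) {e \<in> E. v \<in> e}"
    unfolding bij_betw_def
  proof
    show "inj_on (\<lambda>u. {v, u}) (nbrs E v)"
      by (auto simp: inj_on_def doubleton_eq_iff)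
    show "(\<lambda>u. {v, u}) ` nbrs E v = {e \<in> E. v \<in> e}"
      unfolding nbrs_def using simple_graph_edgeE'[OF assms] by blast
  qed
  then show ?thesis unfolding degree_def by (simp add: bij_betw_same_card)
qed

lemma degree_insert:
  assumes "finite E" "e \<notin> E"
  shows "degree (insert e E) u = degree E u + of_bool (u \<in> e)"
proof -
  have "{f \<in> insert e E. u \<in> f} = (if u \<in> e then insert e {f \<in> E. u \<in> f} else {f \<in> E. u \<in> f})"
    by auto
  then show ?thesis unfolding degree_def using assms by simp
qed

lemma degree_remove:
  assumes "finite E" "e \<in> E"
  shows "degree E u = degree (E - {e}) u + of_bool (u \<in> e)"
  using degree_insert[of "E - {e}" e u] assms by (simp add: insert_absorb)

lemma handshake:
  assumes "simple_graph V E"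
  shows "(\<Sum>v\<in>V. degree E v) = 2 * card E"
proof -
  have fin: "finite E" "finite V"
    using simple_graph_finite assms unfolding simple_graph_def by blast+
  have "(\<Sum>v\<in>V. degree E v) = (\<Sum>v\<in>V. \<Sum>e\<in>E. of_bool (v \<in> e))"
    unfolding degree_def using fin by (simp add: of_bool_def sum.If_cases Int_def)
  also have "\<dots> = (\<Sum>e\<in>E. \<Sum>v\<in>V. of_bool (v \<in> e))" by (rule sum.swap)
  also have "\<dots> = (\<Sum>e\<in>E. 2)"
  proof (rule sum.cong[OF refl])
    fix e assume "e \<in> E"
    then have "V \<inter> {v. v \<in> e} = e" "card e = 2" using assms unfolding simple_graph_def by auto
    then show "(\<Sum>v\<in>V. of_bool (v \<in> e)) = (2::nat)"
      using fin by (simp add: of_bool_def sum.If_cases)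
  qed
  finally show ?thesis by simp
qed

lemma realizes_sum: "realizes V d E \<Longrightarrow> (\<Sum>v\<in>V. d v) = 2 * card E"
  using handshake[of V E] unfolding realizes_def by simp

lemma realizes_card_nbrs: "realizes V d E \<Longrightarrow> v \<in> V \<Longrightarrow> card (nbrs E v) = d v"
  unfolding realizes_def using degree_eq_card_nbrs[of V E v] by simp

lemma realizes_less_card:
  assumes "realizes V d E" "v \<in> V" shows "d v < card V"
proof -
  have "finite V" "nbrs E v \<subseteq> V - {v}"
    using assms nbrs_sub[of V E v] unfolding realizes_def simple_graph_def by auto
  then have "card (nbrs E v) < card V"
    by (metis assms(2) card_Diff1_less card_mono finite_Diff order_le_less_trans)
  then show ?thesis using realizes_card_nbrs[OF assms] by simp
qed

section \<open>Deleting and adding a vertex\<close>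

lemma card_delete_vertex:
  assumes "finite E"
  shows "card E = card (delete_vertex E v) + degree E v"
proof -
  have "E = delete_vertex E v \<union> {e \<in> E. v \<in> e}" unfolding delete_vertex_def by auto
  moreover have "delete_vertex E v \<inter> {e \<in> E. v \<in> e} = {}" unfolding delete_vertex_def by auto
  moreover have "finite (delete_vertex E v)" "finite {e \<in> E. v \<in> e}"
    unfolding delete_vertex_def using assms by auto
  ultimately show ?thesis unfolding degree_def by (metis card_Un_disjoint)
qed

lemma degree_delete_vertex:
  assumes "simple_graph V E" "u \<noteq> v"
  shows "degree E u = degree (delete_vertex E v) u + of_bool (u \<in> nbrs E v)"
proof -
  have "finite E" using assms simple_graph_finite by blast
  then have fin: "finite {e \<in> delete_vertex E v. u \<in> e}" unfolding delete_vertex_def by auto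
  have eq: "{e \<in> E. u \<in> e} = {e \<in> delete_vertex E v. u \<in> e} \<union> {e \<in> E. e = {v, u}}"
    unfolding delete_vertex_def using simple_graph_edgeE'[OF assms(1)] assms(2) by blast
  have nin: "{v, u} \<notin> {e \<in> delete_vertex E v. u \<in> e}" unfolding delete_vertex_def by auto
  have "{e \<in> E. e = {v, u}} = (if {v, u} \<in> E then {{v, u}} else {})" by auto
  then show ?thesis
    unfolding degree_def eq using fin nin by (auto simp: nbrs_def)
qed

lemma simple_graph_delete_vertex:
  "simple_graph V E \<Longrightarrow> simple_graph (V - {v}) (delete_vertex E v)"
  unfolding simple_graph_def delete_vertex_def by auto

text \<open>The subtraction never truncates: a neighbour of \<open>v\<close> has degree at least one
  because of its edge to \<open>v\<close>.\<close>

lemma realizes_delete_vertex: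
  assumes "realizes V d E"
  shows "realizes (V - {v}) (\<lambda>u. d u - of_bool (u \<in> nbrs E v)) (delete_vertex E v)"
proof -
  have s: "simple_graph V E" and dE: "\<And>u. u \<in> V \<Longrightarrow> degree E u = d u"
    using assms unfolding realizes_def by auto
  have "degree (delete_vertex E v) u = d u - of_bool (u \<in> nbrs E v)" if "u \<in> V - {v}" for u
    using degree_delete_vertex[OF s, of u v] dE[of u] that by auto
  then show ?thesis using simple_graph_delete_vertex[OF s] unfolding realizes_def by simp
qed

lemma realizes_add_vertex:
  assumes "realizes V d E" "v \<notin> V" "N \<subseteq> V"
  shows "realizes (insert v V) (\<lambda>u. if u = v then card N else d u + of_bool (u \<in> N))
           (E \<union> (\<lambda>u. {v, u}) ` N)"
proof -
  let ?F = "E \<union> (\<lambda>u. {v, u}) ` N"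
  have s: "simple_graph V E" and dE: "\<And>u. u \<in> V \<Longrightarrow> degree E u = d u"
    using assms unfolding realizes_def by auto
  have vE: "v \<notin> e" if "e \<in> E" for e using that s assms(2) unfolding simple_graph_def by auto
  have sF: "simple_graph (insert v V) ?F"
    using s assms(2,3) unfolding simple_graph_def by (auto simp: card_insert_if)
  \<comment> \<open>Since deleting \<open>v\<close> gives back \<open>E\<close>, the degrees in
    \<open>?F\<close> can be read off from \<open>degree_delete_vertex\<close>.\<close>
  have del: "delete_vertex ?F v = E" unfolding delete_vertex_def using vE by auto
  have nb: "nbrs ?F v = N" unfolding nbrs_def using vE by (auto simp: doubleton_eq_iff)
  have "degree ?F v = card N" using degree_eq_card_nbrs[OF sF] nb by simp
  moreover have "degree ?F u = d u + of_bool (u \<in> N)" if "u \<in> V" "u \<noteq> v" for u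
    using degree_delete_vertex[OF sF that(2)] del nb dE that by simp
  ultimately show ?thesis using sF unfolding realizes_def by auto
qed

subsection \<open>Connectivity and spanning trees\<close>

text \<open>Edges have no direction, so reachability is symmetric and any two vertices are linked
  through a common root.\<close>

lemma graph_connectedI:
  assumes "r \<in> V" "\<And>v. v \<in> V \<Longrightarrow> (r, v) \<in> {(x, y). {x, y} \<in> E}\<^sup>*"
  shows "graph_connected V E"
proof -
  let ?R = "{(x, y). {x, y} \<in> E}"
  have "sym ?R" by (auto simp: sym_def insert_commute)
  then have "sym (?R\<^sup>*)" by (rule sym_rtrancl)
  then have "(u, v) \<in> ?R\<^sup>*" if "u \<in> V" "v \<in> V" for u v
    using assms(2)[OF that(1)] assms(2)[OF that(2)] by (meson rtrancl_trans symD)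
  then show ?thesis using assms(1) unfolding graph_connected_def by auto
qed

text \<open>Each edge of a walk in \<open>E\<close> is replaced by a walk in \<open>F\<close>. This
  serves both subdivision and the removal of cycle edges.\<close>

lemma graph_connected_refine:
  assumes "graph_connected V E" "\<And>x y. {x, y} \<in> E \<Longrightarrow> (x, y) \<in> {(x, y). {x, y} \<in> F}\<^sup>*"
  shows "graph_connected V F"
proof -
  have "{(x, y). {x, y} \<in> E} \<subseteq> {(x, y). {x, y} \<in> F}\<^sup>*" using assms(2) by auto
  then have "{(x, y). {x, y} \<in> E}\<^sup>* \<subseteq> {(x, y). {x, y} \<in> F}\<^sup>*"
    by (rule rtrancl_subset_rtrancl)
  then show ?thesis using assms(1) unfolding graph_connected_def by blast
qed

lemma graph_connected_mono: "graph_connected V E \<Longrightarrow> E \<subseteq> F \<Longrightarrow> graph_connected V F"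
  by (rule graph_connected_refine) auto

lemma graph_connected_add_leaf:
  assumes "graph_connected V E" "a \<in> V"
  shows "graph_connected (insert v V) (insert {v, a} E)"
proof (rule graph_connectedI)
  show "a \<in> insert v V" using assms by simp
  fix u assume u: "u \<in> insert v V"
  let ?R = "{(x, y). {x, y} \<in> insert {v, a} E}"
  have c: "graph_connected V (insert {v, a} E)" using assms(1) by (rule graph_connected_mono) auto
  have "(a, v) \<in> ?R\<^sup>*" by (auto simp: insert_commute)
  then show "(a, u) \<in> ?R\<^sup>*" using u c assms(2) unfolding graph_connected_def by auto
qed

text \<open>If \<open>{a, b}\<close> was an edge, its ends stay linked through \<open>v\<close>; if
  it was not, no edge is lost. \<open>packable_pinch\<close> meets both situations.\<close>

lemma graph_connected_subdivide:
  assumes "graph_connected V E" "a \<in> V"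
  shows "graph_connected (insert v V) (insert {v, a} (insert {v, b} (E - {{a, b}})))"
proof -
  let ?F = "insert {v, a} (insert {v, b} (E - {{a, b}}))"
  have 1: "({(x, y). {x, y} \<in> ?F}) `` {a} \<supseteq> {v}" "({(x, y). {x, y} \<in> ?F}) `` {b} \<supseteq> {v}"
    "({(x, y). {x, y} \<in> ?F}) `` {v} \<supseteq> {a, b}"
    by (auto simp: insert_commute)
  have "graph_connected V ?F"
  proof (rule graph_connected_refine[OF assms(1)])
    fix x y assume xy: "{x, y} \<in> E"
    show "(x, y) \<in> {(x, y). {x, y} \<in> ?F}\<^sup>*"
    proof (cases "{x, y} = {a, b}")
      case True
      then have "(x, v) \<in> {(x, y). {x, y} \<in> ?F}" "(v, y) \<in> {(x, y). {x, y} \<in> ?F}"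
        using 1 by (auto simp: doubleton_eq_iff)
      then show ?thesis by (meson converse_rtrancl_into_rtrancl r_into_rtrancl)
    next
      case False
      then show ?thesis using xy by auto
    qed
  qed
  then have "graph_connected (insert v V) (insert {v, a} ?F)"
    using assms(2) by (rule graph_connected_add_leaf)
  then show ?thesis by simp
qed

text \<open>A walk from \<open>r\<close> to \<open>z\<close> has to leave \<open>S\<close> along
  some edge; the induction follows the walk.\<close>

lemma graph_connected_crossing_edge:
  assumes "graph_connected V E" "r \<in> V" "r \<in> S" "z \<in> V" "z \<notin> S"
  obtains x y where "x \<in> S" "y \<notin> S" "{x, y} \<in> E"
proof -
  have "(r, z) \<in> {(x, y). {x, y} \<in> E}\<^sup>*" using assms unfolding graph_connected_def by auto
  then have "z \<notin> S \<longrightarrow> (\<exists>x y. x \<in> S \<and> y \<notin> S \<and> {x, y} \<in> E)"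
    by (induction rule: rtrancl_induct) (use assms(3) in auto)
  then show ?thesis using that assms(5) by blast
qed

lemma graph_connected_card_le:
  assumes "simple_graph V E" "graph_connected V E"
  shows "card V \<le> card E + 1"
proof -
  have fin: "finite V" "finite E"
    using assms simple_graph_finite unfolding simple_graph_def by blast+
  obtain r where r: "r \<in> V" using assms(2) unfolding graph_connected_def by auto
  \<comment> \<open>The set \<open>S\<close> grows from \<open>r\<close>: each new vertex enters
    along a crossing edge, which is a new edge inside \<open>S\<close>.\<close>
  have "\<exists>S. r \<in> S \<and> S \<subseteq> V \<and> card S = Suc k \<and> k \<le> card {e \<in> E. e \<subseteq> S}" if "Suc k \<le> card V" for k
    using that
  proof (induction k)
    case 0
    then show ?case using r by (intro exI[of _ "{r}"]) auto
  next
    case (Suc k)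
    then obtain S where S: "r \<in> S" "S \<subseteq> V" "card S = Suc k" "k \<le> card {e \<in> E. e \<subseteq> S}" by auto
    have "S \<noteq> V" using S(3) Suc.prems by auto
    then obtain z where "z \<in> V" "z \<notin> S" using S(2) by auto
    then obtain x y where xy: "x \<in> S" "y \<notin> S" "{x, y} \<in> E"
      using graph_connected_crossing_edge[OF assms(2) r S(1)] by metis
    have finS: "finite S" using S(2) fin finite_subset by blast
    have "insert {x, y} {e \<in> E. e \<subseteq> S} \<subseteq> {e \<in> E. e \<subseteq> insert y S}" using xy by auto
    then have "card (insert {x, y} {e \<in> E. e \<subseteq> S}) \<le> card {e \<in> E. e \<subseteq> insert y S}"
      using fin by (intro card_mono) auto
    moreover have "card (insert {x, y} {e \<in> E. e \<subseteq> S}) = Suc (card {e \<in> E. e \<subseteq> S})"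
      using fin xy by (subst card_insert_disjoint) auto
    moreover have "y \<in> V" using simple_graph_edgeD[OF assms(1) xy(3)] by simp
    ultimately show ?case using S xy finS by (intro exI[of _ "insert y S"]) auto
  qed
  moreover have "card V > 0" using r fin card_gt_0_iff by blast
  ultimately obtain S where "S \<subseteq> V" "card V - 1 \<le> card {e \<in> E. e \<subseteq> S}"
    by (metis Suc_pred' order_refl)
  moreover have "card {e \<in> E. e \<subseteq> S} \<le> card E" using fin by (intro card_mono) auto
  ultimately show ?thesis by linarith
qed

lemma graph_connected_remove_cycle_edge:
  assumes "graph_connected V E" "is_cycle E xs"
  shows "graph_connected V (E - {{xs ! 0, xs ! 1}})"
proof -
  let ?n = "length xs" and ?F = "E - {{xs ! 0, xs ! 1}}"
  let ?R = "{(x, y). {x, y} \<in> ?F}"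
  have n: "?n \<ge> 3" and dist: "distinct xs"
    and ed: "\<And>i. i < ?n \<Longrightarrow> {xs ! i, xs ! (Suc i mod ?n)} \<in> E"
    using assms(2) unfolding is_cycle_def by auto
  have neq: "xs ! i \<noteq> xs ! j" if "i < ?n" "j < ?n" "i \<noteq> j" for i j
    using that dist nth_eq_iff_index_eq by blast
  \<comment> \<open>The long way round the cycle: from position 1 up to the last position, then back
    to position 0. Distinctness keeps its edges different from the removed one.\<close>
  have "(xs ! 1, xs ! Suc j) \<in> ?R\<^sup>*" if "Suc j < ?n" for j
    using that
  proof (induction j)
    case (Suc j)
    have "{xs ! Suc j, xs ! Suc (Suc j)} \<in> E" using ed[of "Suc j"] Suc.prems by simp
    moreover have "xs ! Suc j \<noteq> xs ! 0" "xs ! Suc (Suc j) \<noteq> xs ! 0"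
      using neq[of "Suc j" 0] neq[of "Suc (Suc j)" 0] Suc.prems by (auto simp del: length_greater_0_conv)
    ultimately have "(xs ! Suc j, xs ! Suc (Suc j)) \<in> ?R" by (auto simp: doubleton_eq_iff)
    then show ?case using Suc by (meson Suc_lessD rtrancl.rtrancl_into_rtrancl)
  qed simp
  from this[of "?n - 2"] have "(xs ! 1, xs ! (?n - 1)) \<in> ?R\<^sup>*"
    using n by (simp add: numeral_2_eq_2 Suc_diff_Suc)
  moreover have "{xs ! (?n - 1), xs ! 0} \<in> E"
  proof -
    have "Suc (?n - 1) = ?n" "?n - 1 < ?n" using n by linarith+
    then show ?thesis using ed[of "?n - 1"] by (metis mod_self)
  qed
  moreover have "xs ! (?n - 1) \<noteq> xs ! 1" "xs ! (?n - 1) \<noteq> xs ! 0"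
  proof -
    have "?n - 1 < ?n" "1 < ?n" "0 < ?n" "?n - 1 \<noteq> 1" "?n - 1 \<noteq> 0" using n by linarith+
    then show "xs ! (?n - 1) \<noteq> xs ! 1" "xs ! (?n - 1) \<noteq> xs ! 0" using neq by blast+
  qed
  ultimately have 10: "(xs ! 1, xs ! 0) \<in> ?R\<^sup>*"
    by (auto simp: doubleton_eq_iff intro: rtrancl_into_rtrancl)
  have "sym ?R" by (auto simp: sym_def insert_commute)
  then have 01: "(xs ! 0, xs ! 1) \<in> ?R\<^sup>*" using 10 by (meson symD sym_rtrancl)
  show ?thesis
  proof (rule graph_connected_refine[OF assms(1)])
    fix x y assume "{x, y} \<in> E"
    then show "(x, y) \<in> ?R\<^sup>*"
      using 10 01 by (cases "{x, y} = {xs ! 0, xs ! 1}") (auto simp: doubleton_eq_iff)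
  qed
qed

text \<open>Edges on cycles are removed one by one; connectivity is kept, and finiteness ends the
  process.\<close>

lemma graph_connected_has_spanning_tree:
  assumes "simple_graph V E" "graph_connected V E"
  obtains T where "spanning_tree V E T"
proof -
  have "finite E" using assms simple_graph_finite by blast
  then have "\<exists>T\<subseteq>E. graph_connected V T \<and> (\<nexists>xs. is_cycle T xs)"
    using assms(2)
  proof (induction E rule: finite_psubset_induct)
    case (psubset E)
    show ?case
    proof (cases "\<exists>xs. is_cycle E xs")
      case True
      then obtain xs where xs: "is_cycle E xs" by blast
      let ?F = "E - {{xs ! 0, xs ! 1}}"
      have len: "length xs \<ge> 3" using xs unfolding is_cycle_def by simp
      have "0 < length xs \<longrightarrow> {xs ! 0, xs ! (Suc 0 mod length xs)} \<in> E"
        using xs unfolding is_cycle_def by blast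
      moreover have "Suc 0 mod length xs = 1" using len by simp
      ultimately have "{xs ! 0, xs ! 1} \<in> E" using len by (metis gr0I not_numeral_le_zero)
      then have "?F \<subset> E" by auto
      then show ?thesis
        using psubset.IH[of ?F] graph_connected_remove_cycle_edge[OF psubset.prems xs] by blast
    qed (use psubset.prems in blast)
  qed
  then show ?thesis
    using that assms(1) simple_graph_subset unfolding spanning_tree_def is_tree_def by blast
qed

subsection \<open>Extending packings by a vertex\<close>

text \<open>Connected subgraphs take the place of trees, because connectivity survives extra edges;
  trees are extracted only at the end. Edge-disjoint packings are \<open>k = 0\<close>, the theorem
  is about \<open>k = 1\<close>.\<close>

definition packable :: "nat \<Rightarrow> 'a set \<Rightarrow> ('a \<Rightarrow> nat) \<Rightarrow> bool" where
  "packable k V d \<longleftrightarrow> (\<exists>E C1 C2. realizes V d E \<and> C1 \<subseteq> E \<and> C2 \<subseteq> E \<and>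
     graph_connected V C1 \<and> graph_connected V C2 \<and> card (C1 \<inter> C2) \<le> k)"

lemma realizes_cong: "(\<And>v. v \<in> V \<Longrightarrow> d v = d' v) \<Longrightarrow> realizes V d E \<longleftrightarrow> realizes V d' E"
  unfolding realizes_def by auto

lemma packable_cong: "(\<And>v. v \<in> V \<Longrightarrow> d v = d' v) \<Longrightarrow> packable k V d \<longleftrightarrow> packable k V d'"
  unfolding packable_def using realizes_cong[of V d d'] by simp

lemma realizes_finite: "realizes V d E \<Longrightarrow> finite V" "realizes V d E \<Longrightarrow> finite E"
  unfolding realizes_def using simple_graph_finite by (auto simp: simple_graph_def)

text \<open>\<open>v\<close> becomes a leaf at \<open>p\<close> in one subgraph and at
  \<open>q\<close> in the other; when \<open>p = q\<close>, the new edge is shared.\<close>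

lemma packable_add_vertex:
  assumes "packable k V d" "v \<notin> V" "N \<subseteq> V" "p \<in> N" "q \<in> N"
  shows "packable (k + of_bool (p = q)) (insert v V)
           (\<lambda>u. if u = v then card N else d u + of_bool (u \<in> N))"
proof -
  obtain E C1 C2 where E: "realizes V d E" and C: "C1 \<subseteq> E" "C2 \<subseteq> E"
    "graph_connected V C1" "graph_connected V C2" "card (C1 \<inter> C2) \<le> k"
    using assms(1) unfolding packable_def by blast
  let ?D1 = "insert {v, p} C1" and ?D2 = "insert {v, q} C2"
  have fin: "finite (C1 \<inter> C2)" using C(1) realizes_finite[OF E] finite_subset by blast
  have "{v, x} \<notin> E" for x
    using E assms(2) unfolding realizes_def simple_graph_def by blast
  then have "?D1 \<inter> ?D2 \<subseteq> (if p = q then insert {v, p} (C1 \<inter> C2) else C1 \<inter> C2)"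
    using C by (auto simp: doubleton_eq_iff)
  then have "card (?D1 \<inter> ?D2) \<le> card (if p = q then insert {v, p} (C1 \<inter> C2) else C1 \<inter> C2)"
    using fin by (intro card_mono) auto
  also have "\<dots> \<le> k + of_bool (p = q)"
    using C(5) fin by (auto simp: card_insert_if)
  finally have "card (?D1 \<inter> ?D2) \<le> k + of_bool (p = q)" .
  moreover have "graph_connected (insert v V) ?D1" "graph_connected (insert v V) ?D2"
    using graph_connected_add_leaf[OF C(3), of p v] graph_connected_add_leaf[OF C(4), of q v]
      assms(3-5) by auto
  moreover have "?D1 \<subseteq> E \<union> (\<lambda>u. {v, u}) ` N" "?D2 \<subseteq> E \<union> (\<lambda>u. {v, u}) ` N"
    using C assms(4,5) by auto
  ultimately show ?thesis
    using realizes_add_vertex[OF E assms(2,3)] unfolding packable_def by blast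
qed

lemma packable_if_delete_vertex:
  assumes E: "realizes V d E" and "v \<in> V" "p \<in> nbrs E v" "q \<in> nbrs E v"
    and P: "packable k (V - {v}) (\<lambda>u. d u - of_bool (u \<in> nbrs E v))"
  shows "packable (k + of_bool (p = q)) V d"
proof -
  have s: "simple_graph V E" using E unfolding realizes_def by simp
  \<comment> \<open>Subtracting one and adding it back restores \<open>d u\<close> only if
    \<open>d u\<close> is positive.\<close>
  have pos: "d u \<ge> 1" if "u \<in> nbrs E v" for u
  proof -
    have "v \<in> nbrs E u" "u \<in> V" using that nbrs_sym[of u E v] nbrs_sub[OF s, of v] by auto
    moreover have "finite (nbrs E u)"
      using nbrs_sub[OF s, of u] realizes_finite(1)[OF E] by (meson finite_Diff finite_subset)
    ultimately have "card (nbrs E u) > 0" by (auto simp: card_gt_0_iff)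
    then show ?thesis using realizes_card_nbrs[OF E \<open>u \<in> V\<close>] by simp
  qed
  let ?d = "\<lambda>u. if u = v then card (nbrs E v)
          else d u - of_bool (u \<in> nbrs E v) + of_bool (u \<in> nbrs E v)"
  have "packable (k + of_bool (p = q)) (insert v (V - {v})) ?d"
    by (rule packable_add_vertex[OF P]) (use nbrs_sub[OF s, of v] assms(3,4) in auto)
  moreover have "insert v (V - {v}) = V" using assms(2) by auto
  ultimately have "packable (k + of_bool (p = q)) V ?d" by (simp only:)
  moreover have "?d u = d u" if "u \<in> V" for u
    using pos[of u] realizes_card_nbrs[OF E assms(2)] by auto
  then have "packable j V ?d \<longleftrightarrow> packable j V d" for j by (rule packable_cong)
  ultimately show ?thesis by (simp only:)
qed

text \<open>An edge avoiding \<open>c\<close> is subdivided by \<open>v\<close>, which leaves the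
  degrees of its ends alone, and \<open>v\<close> is joined to \<open>c\<close>. One subgraph runs
  through the subdivided edge, the other reaches \<open>v\<close> from \<open>c\<close>.\<close>

lemma packable_pinch:
  assumes P: "packable k V d" and "k \<le> 1" "v \<notin> V" "c \<in> V" "card V \<ge> 4"
    and sum: "4 * card V \<le> (\<Sum>u\<in>V. d u) + 4 + 2 * k"
  shows "packable k (insert v V) (d(c := d c + 1, v := 3))"
proof -
  obtain E C1 C2 where E: "realizes V d E" and C: "C1 \<subseteq> E" "C2 \<subseteq> E"
    "graph_connected V C1" "graph_connected V C2" "card (C1 \<inter> C2) \<le> k"
    using P unfolding packable_def by blast
  have s: "simple_graph V E" using E unfolding realizes_def by simp
  have fin: "finite E" "finite V" using realizes_finite[OF E] by auto
  \<comment> \<open>At most \<open>card V - 1\<close> edges meet \<open>c\<close>, so at least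
    \<open>card V - 1 - k\<close> avoid it. This exceeds \<open>k\<close> for
    \<open>card V \<ge> 4\<close> and \<open>k \<le> 1\<close>, so one of them is not
    shared.\<close>
  have "2 * card V \<le> card E + 2 + k" using sum realizes_sum[OF E] by simp
  moreover have "card E = card (delete_vertex E c) + d c"
    using card_delete_vertex[OF fin(1), of c] E assms(4) unfolding realizes_def by simp
  moreover have "d c < card V" using realizes_less_card[OF E assms(4)] .
  ultimately have "card (delete_vertex E c) > card (C1 \<inter> C2)"
    using assms(2,5) C(5) by linarith
  moreover have "finite (C1 \<inter> C2)" using C(1) fin finite_subset by blast
  ultimately have "\<not> delete_vertex E c \<subseteq> C1 \<inter> C2"
    using card_mono[of "C1 \<inter> C2" "delete_vertex E c"] by linarith
  then obtain e where e: "e \<in> E" "c \<notin> e" "e \<notin> C1 \<inter> C2"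
    unfolding delete_vertex_def by auto
  \<comment> \<open>\<open>e\<close> becomes the path through \<open>v\<close> in the first subgraph (if it was not in it, this only
    adds edges), and \<open>v\<close> is a leaf at \<open>c\<close> in the second.\<close>
  obtain D1 D2 where D: "D1 \<subseteq> E" "D2 \<subseteq> E" "graph_connected V D1" "graph_connected V D2"
    "card (D1 \<inter> D2) \<le> k" "e \<notin> D2"
    using C e(3) by (cases "e \<in> C2") (auto simp: Int_commute)
  obtain a b where ab: "e = {a, b}" "a \<noteq> b" "a \<in> V" "b \<in> V"
    using simple_graph_edgeE[OF s e(1)] by blast
  have nab: "a \<noteq> c" "b \<noteq> c" using e(2) ab(1) by auto
  let ?E0 = "E - {e}"
  let ?F = "?E0 \<union> (\<lambda>u. {v, u}) ` {a, b, c}"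
  have vE: "{v, x} \<notin> E" for x
    using s assms(3) unfolding simple_graph_def by blast
  have "degree ?E0 u = d u - of_bool (u \<in> e)" if "u \<in> V" for u
    using degree_remove[OF fin(1) e(1), of u] that E unfolding realizes_def by simp
  then have "realizes V (\<lambda>u. d u - of_bool (u \<in> e)) ?E0"
    using simple_graph_subset[OF s, of ?E0] unfolding realizes_def by auto
  then have "realizes (insert v V) (\<lambda>u. if u = v then card {a, b, c}
      else d u - of_bool (u \<in> e) + of_bool (u \<in> {a, b, c})) ?F"
    by (rule realizes_add_vertex) (use assms(3,4) ab in auto)
  moreover have "(if u = v then card {a, b, c}
      else d u - of_bool (u \<in> e) + of_bool (u \<in> {a, b, c})) = (d(c := d c + 1, v := 3)) u"
    if "u \<in> insert v V" for u
  proof -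
    have "d x \<ge> 1" if "x \<in> {a, b}" for x
      using degree_remove[OF fin(1) e(1), of x] that ab E unfolding realizes_def by auto
    then show ?thesis using nab ab assms(3,4) by auto
  qed
  ultimately have F: "realizes (insert v V) (d(c := d c + 1, v := 3)) ?F"
    by (subst realizes_cong[symmetric])
  let ?D1 = "insert {v, a} (insert {v, b} (D1 - {{a, b}}))" and ?D2 = "insert {v, c} D2"
  have "graph_connected (insert v V) ?D1" "graph_connected (insert v V) ?D2"
    using graph_connected_subdivide[OF D(3) ab(3)] graph_connected_add_leaf[OF D(4) assms(4)]
    by simp_all
  moreover have "?D1 \<subseteq> ?F" "?D2 \<subseteq> ?F" using D(1,2,6) ab(1) by auto
  \<comment> \<open>No edge at \<open>v\<close> is shared: one subgraph uses those to
    \<open>a\<close> and \<open>b\<close>, the other the one to \<open>c\<close>.\<close>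
  moreover have "?D1 \<inter> ?D2 \<subseteq> D1 \<inter> D2"
    using vE D(1,2) nab by (auto simp: doubleton_eq_iff)
  then have "card (?D1 \<inter> ?D2) \<le> k"
    using D(1,5) fin(1) by (meson card_mono finite_Int finite_subset order_trans)
  ultimately show ?thesis unfolding packable_def
    by (intro exI[of _ ?F] exI[of _ ?D1] exI[of _ ?D2] conjI F)
qed

subsection \<open>Switching and pinching\<close>

text \<open>The Havel-Hakimi exchange: for some neighbour \<open>y\<close> of \<open>w\<close> that
  is not adjacent to \<open>a\<close>, the edges \<open>va\<close>, \<open>wy\<close> are replaced
  by \<open>vw\<close>, \<open>ay\<close>.\<close>

lemma realizes_switch:
  assumes E: "realizes V d E" and va: "{v, a} \<in> E" and w: "w \<in> V" "w \<noteq> v" "{v, w} \<notin> E"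
    and less: "d a < d w"
  obtains F where "realizes V d F" "nbrs F v = insert w (nbrs E v - {a})"
proof -
  have s: "simple_graph V E" and dE: "\<And>u. u \<in> V \<Longrightarrow> degree E u = d u"
    using E unfolding realizes_def by auto
  have fin: "finite E" "finite V" using realizes_finite[OF E] by auto
  have av: "a \<in> V" "v \<in> V" "a \<noteq> v" using simple_graph_edgeD[OF s va] by auto
  have finN: "finite (nbrs E u)" for u
    using nbrs_sub[OF s, of u] fin(2) by (meson finite_Diff finite_subset)
  \<comment> \<open>A count yields \<open>y\<close>. Adjacency of \<open>a\<close> and
    \<open>w\<close> lowers both sides equally, and \<open>v\<close> is a neighbour of
    \<open>a\<close> only, so an inclusion would contradict \<open>d a < d w\<close>.\<close>
  have "\<not> nbrs E w - {a} \<subseteq> nbrs E a - {w, v}"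
  proof
    assume "nbrs E w - {a} \<subseteq> nbrs E a - {w, v}"
    then have "card (nbrs E w - {a}) \<le> card (nbrs E a - {w, v})"
      using finN by (intro card_mono) auto
    moreover have "card (nbrs E w - {a}) = d w - of_bool (a \<in> nbrs E w)"
      using realizes_card_nbrs[OF E w(1)] finN by (simp add: card_Diff_singleton_if)
    moreover have "card (nbrs E a - {w, v}) = d a - of_bool (w \<in> nbrs E a) - 1"
    proof -
      have "v \<in> nbrs E a - {w}" using va w(2) unfolding nbrs_def by (auto simp: insert_commute)
      then have "card (nbrs E a - {w} - {v}) = card (nbrs E a - {w}) - 1"
        by (rule card_Diff_singleton)
      moreover have "nbrs E a - {w, v} = nbrs E a - {w} - {v}" by auto
      ultimately show ?thesis
        using realizes_card_nbrs[OF E av(1)] finN by (simp add: card_Diff_singleton_if)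
    qed
    moreover have "a \<in> nbrs E w \<longleftrightarrow> w \<in> nbrs E a" by (rule nbrs_sym)
    moreover have "card (nbrs E a) > 0"
      using va finN card_gt_0_iff unfolding nbrs_def by (force simp: insert_commute)
    ultimately show False using less realizes_card_nbrs[OF E av(1)] by (auto split: if_splits)
  qed
  moreover have "w \<notin> nbrs E w" "v \<notin> nbrs E w"
    using w(3) nbrs_sub[OF s, of w] nbrs_sym[of v E w] unfolding nbrs_def by blast+
  ultimately obtain y where "y \<in> nbrs E w" "y \<notin> nbrs E a" "y \<noteq> a" "y \<noteq> w" "y \<noteq> v"
    by blast
  then have y: "{w, y} \<in> E" "{a, y} \<notin> E" "y \<noteq> a" "y \<noteq> w" "y \<noteq> v"
    unfolding nbrs_def by auto
  have yV: "y \<in> V" using simple_graph_edgeD[OF s y(1)] by simp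
  have aw: "a \<noteq> w" using va w(3) by auto
  \<comment> \<open>The four changes are made one at a time, so that each is a single removal or
    insertion; each of \<open>v\<close>, \<open>a\<close>, \<open>w\<close>, \<open>y\<close> loses
    one edge and gains one.\<close>
  let ?E1 = "E - {{v, a}}" let ?E2 = "?E1 - {{w, y}}"
  let ?E3 = "insert {v, w} ?E2" let ?F = "insert {a, y} ?E3"
  have wy1: "{w, y} \<in> ?E1" using y w aw by (auto simp: doubleton_eq_iff)
  have n2: "{v, w} \<notin> ?E2" using w(3) by auto
  have n3: "{a, y} \<notin> ?E3" using y av aw by (auto simp: doubleton_eq_iff)
  have "simple_graph V ?E2" using simple_graph_subset[OF s, of ?E2] by auto
  then have "simple_graph V ?E3" using simple_graph_insert w av by metis
  then have sF: "simple_graph V ?F" using simple_graph_insert yV av(1) y(3) by metis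
  have "degree ?F u = d u" if "u \<in> V" for u
  proof -
    have "degree E u = degree ?E1 u + of_bool (u \<in> {v, a})"
      by (rule degree_remove[OF fin(1) va])
    moreover have "degree ?E1 u = degree ?E2 u + of_bool (u \<in> {w, y})"
      by (rule degree_remove[OF _ wy1]) (use fin in simp)
    moreover have "degree ?E3 u = degree ?E2 u + of_bool (u \<in> {v, w})"
      by (rule degree_insert[OF _ n2]) (use fin in simp)
    moreover have "degree ?F u = degree ?E3 u + of_bool (u \<in> {a, y})"
      by (rule degree_insert[OF _ n3]) (use fin in simp)
    ultimately show ?thesis using dE[OF that] aw av(3) w(2) y(3-5) by auto
  qed
  then have "realizes V d ?F" using sF unfolding realizes_def by blast
  moreover have "nbrs ?F v = insert w (nbrs E v - {a})"
    unfolding nbrs_def using aw av(3) w(2) y(3-5) by (auto simp: doubleton_eq_iff)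
  ultimately show ?thesis by (rule that)
qed

text \<open>While \<open>v\<close> has a neighbour of degree below \<open>t\<close> and a
  non-neighbour of degree at least \<open>t\<close>, a switch exchanges them, and the number of low
  neighbours drops. By \<open>d v < t\<close>, the high vertex is never \<open>v\<close>
  itself.\<close>

lemma realizes_switch_threshold:
  assumes E: "realizes V d E" and "v \<in> V" "d v < t"
  obtains F where "realizes V d F" "nbrs F v \<subseteq> {u \<in> V. t \<le> d u} \<or> {u \<in> V. t \<le> d u} \<subseteq> nbrs F v"
proof -
  let ?H = "{u \<in> V. t \<le> d u}"
  have "\<exists>F. realizes V d F \<and> (nbrs F v \<subseteq> ?H \<or> ?H \<subseteq> nbrs F v)"
    using E
  proof (induction "card (nbrs E v - ?H)" arbitrary: E rule: less_induct)
    case less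
    have s: "simple_graph V E" using less.prems unfolding realizes_def by simp
    have fin: "finite (nbrs E v)"
      using nbrs_sub[OF s, of v] realizes_finite(1)[OF less.prems] by (meson finite_Diff finite_subset)
    show ?case
    proof (cases "nbrs E v \<subseteq> ?H \<or> ?H \<subseteq> nbrs E v")
      case False
      then obtain a w where a: "a \<in> nbrs E v" "a \<notin> ?H" and w: "w \<in> ?H" "w \<notin> nbrs E v" by blast
      have aV: "a \<in> V" using a(1) nbrs_sub[OF s, of v] by auto
      have "{v, a} \<in> E" "w \<in> V" "w \<noteq> v" "{v, w} \<notin> E" "d a < d w"
        using a w aV assms(3) unfolding nbrs_def by auto
      then obtain F where F: "realizes V d F" "nbrs F v = insert w (nbrs E v - {a})"
        using realizes_switch[OF less.prems] by blast
      have "nbrs F v - ?H \<subset> nbrs E v - ?H" using F(2) a w by auto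
      then have "card (nbrs F v - ?H) < card (nbrs E v - ?H)" using fin by (intro psubset_card_mono) auto
      then show ?thesis using less.hyps F(1) by blast
    qed (use less.prems in blast)
  qed
  then show ?thesis using that by blast
qed

text \<open>The reverse of the construction in \<open>packable_pinch\<close>: the edge
  \<open>ab\<close> makes up for what \<open>a\<close> and \<open>b\<close> lose with
  \<open>v\<close>, so only \<open>c\<close> loses degree.\<close>

lemma realizes_pinch:
  assumes E: "realizes V d E" and v: "v \<in> V" and N: "nbrs E v = {a, b, c}"
    and dist: "a \<noteq> b" "a \<noteq> c" "b \<noteq> c" and "{a, b} \<notin> E"
  shows "realizes (V - {v}) (d(c := d c - 1)) (insert {a, b} (delete_vertex E v))"
proof -
  let ?G = "delete_vertex E v"
  have G: "realizes (V - {v}) (\<lambda>u. d u - of_bool (u \<in> {a, b, c})) ?G"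
    using realizes_delete_vertex[OF E, of v] N by simp
  have s: "simple_graph V E" using E unfolding realizes_def by simp
  have abV: "a \<in> V - {v}" "b \<in> V - {v}" using nbrs_sub[OF s, of v] N by auto
  have sF: "simple_graph (V - {v}) (insert {a, b} ?G)"
    using G simple_graph_insert[OF _ abV dist(1)] unfolding realizes_def by blast
  have nG: "{a, b} \<notin> ?G" using assms(7) unfolding delete_vertex_def by simp
  have pos: "d u \<ge> 1" if "u \<in> {a, b, c}" for u
    using that degree_delete_vertex[OF s, of u v] E N nbrs_sub[OF s, of v] unfolding realizes_def by auto
  have "degree (insert {a, b} ?G) u = (d(c := d c - 1)) u" if "u \<in> V - {v}" for u
    using degree_insert[OF realizes_finite(2)[OF G] nG, of u] G that pos[of u] dist
    unfolding realizes_def by auto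
  then show ?thesis using sF unfolding realizes_def by blast
qed

text \<open>The substitute when \<open>ab\<close> is already an edge: \<open>xy\<close> is split
  into \<open>xa\<close> and \<open>yb\<close>, which repays \<open>a\<close> and \<open>b\<close>
  and keeps the degrees of \<open>x\<close> and \<open>y\<close>.\<close>

lemma realizes_pinch_switch:
  assumes E: "realizes V d E" and v: "v \<in> V" and N: "nbrs E v = {a, b, c}"
    and dist: "a \<noteq> b" "a \<noteq> c" "b \<noteq> c"
    and xy: "{x, y} \<in> E" "x \<notin> insert v {a, b, c}" "y \<notin> insert v {a, b, c}" "{x, a} \<notin> E" "{y, b} \<notin> E"
  shows "realizes (V - {v}) (d(c := d c - 1))
     (insert {y, b} (insert {x, a} (delete_vertex E v - {{x, y}})))"
proof -
  let ?G = "delete_vertex E v"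
  let ?E1 = "?G - {{x, y}}"
  let ?E2 = "insert {x, a} ?E1" let ?F = "insert {y, b} ?E2"
  have G: "realizes (V - {v}) (\<lambda>u. d u - of_bool (u \<in> {a, b, c})) ?G"
    using realizes_delete_vertex[OF E, of v] N by simp
  have s: "simple_graph V E" using E unfolding realizes_def by simp
  have abV: "a \<in> V - {v}" "b \<in> V - {v}" using nbrs_sub[OF s, of v] N by auto
  have xyV: "x \<in> V - {v}" "y \<in> V - {v}" "x \<noteq> y" using simple_graph_edgeD[OF s xy(1)] xy(2,3) by auto
  have finG: "finite ?G" using realizes_finite(2)[OF G] .
  have "simple_graph (V - {v}) ?E1"
    using G simple_graph_subset[of "V - {v}" ?G ?E1] unfolding realizes_def by auto
  then have "simple_graph (V - {v}) ?E2"
    by (rule simple_graph_insert) (use xyV abV xy in auto)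
  then have sF: "simple_graph (V - {v}) ?F"
    by (rule simple_graph_insert) (use xyV abV xy in auto)
  have i0: "{x, y} \<in> ?G" using xy unfolding delete_vertex_def by auto
  have i1: "{x, a} \<notin> ?E1" using xy(4) unfolding delete_vertex_def by auto
  have i2: "{y, b} \<notin> ?E2" using xy dist xyV unfolding delete_vertex_def by (auto simp: doubleton_eq_iff)
  have pos: "d u \<ge> 1" if "u \<in> {a, b, c}" for u
    using that degree_delete_vertex[OF s, of u v] E N nbrs_sub[OF s, of v] unfolding realizes_def by auto
  have "degree ?F u = (d(c := d c - 1)) u" if "u \<in> V - {v}" for u
  proof -
    have "degree ?G u = degree ?E1 u + of_bool (u \<in> {x, y})" by (rule degree_remove[OF finG i0])
    moreover have "degree ?E2 u = degree ?E1 u + of_bool (u \<in> {x, a})"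
      by (rule degree_insert[OF _ i1]) (use finG in simp)
    moreover have "degree ?F u = degree ?E2 u + of_bool (u \<in> {y, b})"
      by (rule degree_insert[OF _ i2]) (use finG in simp)
    moreover have "degree ?G u = d u - of_bool (u \<in> {a, b, c})"
      using G that unfolding realizes_def by blast
    ultimately show ?thesis using pos[of u] dist xy(2,3) xyV(3) by auto
  qed
  then show ?thesis using sF unfolding realizes_def by blast
qed

text \<open>If two neighbours of \<open>v\<close> are not adjacent, they can be joined in place of \<open>v\<close>. Otherwise
  the closed neighbourhood of \<open>v\<close> is a \<open>K\<^sub>4\<close>, and if no edge outside of it can be split to
  compensate two of the neighbours, then double counting gives too many edges.\<close>

lemma realizes_pinch_exists:
  assumes E: "realizes V d E" and v: "v \<in> V" "d v = 3" and min: "\<forall>u\<in>V. 3 \<le> d u"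
    and V5: "5 \<le> card V" and few: "card E + 2 \<le> 2 * card V"
  shows "\<exists>c F. c \<in> V - {v} \<and> realizes (V - {v}) (d(c := d c - 1)) F"
proof (rule ccontr)
  assume none: "\<not> ?thesis"
  define N where "N = nbrs E v"
  have s: "simple_graph V E" using E unfolding realizes_def by simp
  have fin: "finite E" "finite V" using realizes_finite[OF E] by auto
  have NV: "N \<subseteq> V - {v}" using nbrs_sub[OF s] N_def by blast
  have finN: "finite N" using NV fin(2) by (meson finite_Diff finite_subset)
  have cN: "card N = 3" using realizes_card_nbrs[OF E v(1)] v(2) N_def by simp
  have third: "\<exists>c. c \<in> V - {v} \<and> N = {a, b, c} \<and> a \<noteq> c \<and> b \<noteq> c"
    if "a \<in> N" "b \<in> N" "a \<noteq> b" for a b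
  proof -
    have "card (N - {a, b}) = 1"
      using that cN finN by (subst card_Diff_subset) auto
    then obtain c where "N - {a, b} = {c}" by (auto simp: card_1_singleton_iff)
    then show ?thesis using that NV by blast
  qed
  \<comment> \<open>A missing edge inside \<open>N\<close> would allow
    \<open>realizes_pinch\<close>, against \<open>none\<close>. Hence \<open>v\<close> and
    \<open>N\<close> span a complete graph.\<close>
  have adj: "{a, b} \<in> E" if "a \<in> N" "b \<in> N" "a \<noteq> b" for a b
    using third[OF that] realizes_pinch[OF E v(1)] that none N_def by metis
  define U where "U = V - insert v N"
  have cross: "{x, a} \<in> E \<or> {y, b} \<in> E"
    if "{x, y} \<in> E" "x \<in> U" "y \<in> U" "a \<in> N" "b \<in> N" "a \<noteq> b" for x y a b
  proof (rule ccontr)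
    assume no: "\<not> ({x, a} \<in> E \<or> {y, b} \<in> E)"
    obtain c where c: "c \<in> V - {v}" "N = {a, b, c}" "a \<noteq> c" "b \<noteq> c"
      using third[OF \<open>a \<in> N\<close> \<open>b \<in> N\<close> \<open>a \<noteq> b\<close>] by blast
    have "realizes (V - {v}) (d(c := d c - 1))
       (insert {y, b} (insert {x, a} (delete_vertex E v - {{x, y}})))"
      by (rule realizes_pinch_switch[OF E v(1)]) (use c that no N_def U_def in auto)
    then show False using none c(1) by blast
  qed
  define h where "h x = card (nbrs E x \<inter> N)" for x
  \<comment> \<open>\<open>x\<close> misses two vertices \<open>p\<close>, \<open>q\<close> of
    \<open>N\<close>. For each \<open>z\<close> in \<open>N\<close> one of them differs from
    \<open>z\<close>, and \<open>cross\<close> with that one makes \<open>y\<close> adjacent to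
    \<open>z\<close>.\<close>
  have low: "h y = 3" if xy: "{x, y} \<in> E" "x \<in> U" "y \<in> U" and "h x \<le> 1" for x y
  proof -
    have "card (N - nbrs E x) \<ge> 2"
    proof -
      have "card (N - nbrs E x) = card N - card (N \<inter> nbrs E x)"
        using finN by (intro card_Diff_subset_Int) auto
      then show ?thesis using cN \<open>h x \<le> 1\<close> unfolding h_def by (simp add: Int_commute)
    qed
    then obtain p q where pq: "p \<in> N - nbrs E x" "q \<in> N - nbrs E x" "p \<noteq> q"
      by (metis card_le_Suc0_iff_eq card.infinite not_less_eq_eq numeral_2_eq_2 zero_le)
    have "z \<in> nbrs E y" if "z \<in> N" for z
    proof (cases "z = p")
      case True
      then show ?thesis using cross[OF xy, of q z] pq that unfolding nbrs_def by auto
    next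
      case False
      then show ?thesis using cross[OF xy, of p z] pq that unfolding nbrs_def by auto
    qed
    then have "nbrs E y \<inter> N = N" by auto
    then show ?thesis using cN unfolding h_def by simp
  qed
  have cU: "card V = card U + 4"
  proof -
    have "card (insert v N) = 4" using cN finN NV by (subst card_insert_disjoint) auto
    moreover have "insert v N \<subseteq> V" using NV v by auto
    ultimately have "card U = card V - 4"
      unfolding U_def using finN card_Diff_subset[of "insert v N" V] by auto
    then show ?thesis using V5 by linarith
  qed
  then have "U \<noteq> {}" using V5 by auto
  then obtain x0 where x0: "x0 \<in> U" by auto
  have finU: "finite U" unfolding U_def using fin by auto
  \<comment> \<open>Charge to each vertex outside the \<open>K\<^sub>4\<close> its edges into \<open>N\<close>, or all of its edges if it has at most
    one neighbour in \<open>N\<close>; by \<open>low\<close> no edge is charged twice. Every vertex then pays at least 2,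
    and \<open>x0\<close> at least 3, which makes the final inequality strict.\<close>
  define full where "full x \<longleftrightarrow> h x \<le> 1 \<or> (x = x0 \<and> h x \<le> 2)" for x
  define M where "M x = (if full x then nbrs E x else nbrs E x \<inter> N)" for x
  define Own where "Own x = (\<lambda>y. {x, y}) ` M x" for x
  have cOwn: "card (Own x) = card (M x)" for x
    unfolding Own_def by (intro card_image) (auto simp: inj_on_def doubleton_eq_iff)
  have dU: "card (nbrs E x) \<ge> 3" if "x \<in> U" for x
    using that realizes_card_nbrs[OF E] min unfolding U_def by auto
  have M2: "card (M x) \<ge> 2 + of_bool (x = x0)" if "x \<in> U" for x
    using dU[OF that] unfolding M_def full_def h_def by auto
  \<comment> \<open>An edge charged to both ends lies inside \<open>U\<close>, so both ends are
    \<open>full\<close>. Only \<open>x0\<close> may have \<open>h = 2\<close>, so one end has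
    \<open>h \<le> 1\<close>, and \<open>low\<close> gives the other \<open>h = 3\<close>, too many
    for \<open>full\<close>.\<close>
  have disj: "Own x \<inter> Own y = {}" if "x \<in> U" "y \<in> U" "x \<noteq> y" for x y
  proof (rule ccontr)
    assume "Own x \<inter> Own y \<noteq> {}"
    then have "y \<in> M x" "x \<in> M y"
      unfolding Own_def using that(3) by (auto simp: doubleton_eq_iff)
    then have "full x" "full y" "{x, y} \<in> E" "{y, x} \<in> E"
      using that(1,2) unfolding M_def U_def nbrs_def by (auto split: if_splits)
    then show False using low[of x y] low[of y x] that unfolding full_def by auto
  qed
  define K where "K = {e. e \<subseteq> insert v N \<and> card e = 2}"
  have KE: "K \<subseteq> E"
  proof
    fix e assume "e \<in> K"
    then obtain p q where pq: "e = {p, q}" "p \<noteq> q" "p \<in> insert v N" "q \<in> insert v N"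
      unfolding K_def by (auto simp: card_2_iff)
    have vN: "{v, z} \<in> E" "{z, v} \<in> E" if "z \<in> N" for z
      using that unfolding N_def nbrs_def by (simp_all add: insert_commute)
    show "e \<in> E" using pq(2-4) adj vN unfolding pq(1) by blast
  qed
  have cK: "card K = 6"
  proof -
    have "card (insert v N) = 4" using cN finN NV by (subst card_insert_disjoint) auto
    then have "card K = 4 choose 2" unfolding K_def using n_subsets[of "insert v N" 2] finN by simp
    then show ?thesis by (simp add: eval_nat_numeral)
  qed
  have OwnE: "Own x \<subseteq> E" for x unfolding Own_def M_def nbrs_def by (auto split: if_splits)
  have "card (\<Union>x\<in>U. Own x) = (\<Sum>x\<in>U. card (Own x))"
    using disj finite_subset[OF OwnE fin(1)] by (intro card_UN_disjoint finU) blast+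
  also have "\<dots> \<ge> (\<Sum>x\<in>U. 2 + of_bool (x = x0))"
    unfolding cOwn by (rule sum_mono) (rule M2)
  also have "(\<Sum>x\<in>U. 2 + of_bool (x = x0)) = 2 * card U + (1::nat)"
    unfolding sum.distrib of_bool_def using finU x0 by simp
  finally have cUn: "2 * card U + 1 \<le> card (\<Union>x\<in>U. Own x)" .
  \<comment> \<open>Every charged edge has an end in \<open>U\<close>. Together with the six edges
    of \<open>K\<close> there are at least \<open>6 + 2 * (card V - 4) + 1 = 2 * card V - 1\<close>
    edges, one more than \<open>few\<close> allows.\<close>
  have "K \<inter> (\<Union>x\<in>U. Own x) = {}" unfolding K_def Own_def U_def by auto
  then have "card (K \<union> (\<Union>x\<in>U. Own x)) = card K + card (\<Union>x\<in>U. Own x)"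
    using finite_subset[OF KE fin(1)] finite_subset[OF OwnE fin(1)] finU
    by (intro card_Un_disjoint) auto
  moreover have "card (K \<union> (\<Union>x\<in>U. Own x)) \<le> card E"
    using KE OwnE fin(1) by (intro card_mono) auto
  ultimately show False using cUn cK cU few by linarith
qed

subsection \<open>Existence of packings\<close>

lemma packable_mono: "packable j V d \<Longrightarrow> j \<le> k \<Longrightarrow> packable k V d"
  unfolding packable_def by (meson order_trans)

text \<open>Two different neighbours of \<open>v\<close> serve as attachment points, so no further
  edge is shared.\<close>

lemma packable_delete_step:
  assumes E: "realizes V d E" and "v \<in> V" "2 \<le> d v"
    and P: "packable k (V - {v}) (\<lambda>u. d u - of_bool (u \<in> nbrs E v))"
  shows "packable k V d"
proof -
  have "\<not> card (nbrs E v) \<le> Suc 0" using realizes_card_nbrs[OF E assms(2)] assms(3) by simp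
  moreover have "finite (nbrs E v)"
    using realizes_card_nbrs[OF E assms(2)] assms(3) card.infinite by fastforce
  ultimately obtain p q where "p \<in> nbrs E v" "q \<in> nbrs E v" "p \<noteq> q"
    by (auto simp: card_le_Suc0_iff_eq)
  then show ?thesis using packable_if_delete_vertex[OF E assms(2) _ _ P, of p q] by simp
qed

text \<open>From \<open>E\<close> to \<open>F\<close> one vertex and two edges disappear, so the
  edge bound carries over. \<open>P\<close> is an implication with that bound as premise so that an
  induction hypothesis fits it.\<close>

lemma packable_pinch_step:
  assumes E: "realizes V d E" and v: "v \<in> V" "d v = 3" and c: "c \<in> V - {v}" "1 \<le> d c"
    and F: "realizes (V - {v}) (d(c := d c - 1)) F"
    and P: "2 * card (V - {v}) \<le> card F + 2 + k \<Longrightarrow> packable k (V - {v}) (d(c := d c - 1))"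
    and k: "k \<le> 1" and V5: "5 \<le> card V" and many: "2 * card V \<le> card E + 2 + k"
  shows "packable k V d"
proof -
  let ?d = "d(c := d c - 1)"
  have fin: "finite V" using realizes_finite[OF E] by simp
  have cV: "card (V - {v}) = card V - 1" using v fin by simp
  have "(\<Sum>u\<in>V. d u) = d v + (\<Sum>u\<in>V - {v}. d u)" using v fin by (simp add: sum.remove)
  also have "(\<Sum>u\<in>V - {v}. d u) = d c + (\<Sum>u\<in>V - {v} - {c}. d u)"
    using c fin by (simp add: sum.remove)
  also have "(\<Sum>u\<in>V - {v} - {c}. d u) = (\<Sum>u\<in>V - {v} - {c}. ?d u)"
    by (rule sum.cong) auto
  finally have "(\<Sum>u\<in>V. d u) = d v + d c + (\<Sum>u\<in>V - {v} - {c}. ?d u)" by simp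
  moreover have "(\<Sum>u\<in>V - {v}. ?d u) = ?d c + (\<Sum>u\<in>V - {v} - {c}. ?d u)"
    using c fin by (simp add: sum.remove)
  ultimately have sums: "(\<Sum>u\<in>V. d u) = (\<Sum>u\<in>V - {v}. ?d u) + 4" using v c by simp
  have sF: "(\<Sum>u\<in>V - {v}. ?d u) = 2 * card F" using realizes_sum[OF F] .
  then have cF: "card E = card F + 2" using sums realizes_sum[OF E] by simp
  have "packable k (insert v (V - {v})) (?d(c := ?d c + 1, v := 3))"
  proof (rule packable_pinch)
    show "packable k (V - {v}) ?d" using P cF many cV by simp
    show "4 * card (V - {v}) \<le> (\<Sum>u\<in>V - {v}. ?d u) + 4 + 2 * k"
      using sF cF many cV by simp
  qed (use k c cV V5 in auto)
  moreover have "insert v (V - {v}) = V" using v by auto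
  moreover have "?d(c := ?d c + 1, v := 3) = d" using c v by auto
  ultimately show ?thesis by (simp only:)
qed

lemma card_delete_vertex_realizes:
  "realizes V d E \<Longrightarrow> v \<in> V \<Longrightarrow> card E = card (delete_vertex E v) + d v"
  using card_delete_vertex[of E v] realizes_finite[of V d E] unfolding realizes_def by simp

text \<open>Used to force vertices of degree at least three: without enough of them there are too
  few edges.\<close>

lemma realizes_sum_le_high_degrees:
  assumes E: "realizes V d E"
  shows "2 * card E \<le> card {u \<in> V. 3 \<le> d u} * (card V - 1) + 2 * (card V - card {u \<in> V. 3 \<le> d u})"
proof -
  let ?H = "{u \<in> V. 3 \<le> d u}"
  have fin: "finite V" using realizes_finite[OF E] by simp
  have "(\<Sum>u\<in>V. d u) = (\<Sum>u\<in>V - ?H. d u) + (\<Sum>u\<in>?H. d u)"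
    using fin by (intro sum.subset_diff) auto
  moreover have "(\<Sum>u\<in>?H. d u) \<le> card ?H * (card V - 1)"
    using realizes_less_card[OF E] sum_bounded_above[of ?H d "card V - 1"] by fastforce
  moreover have "(\<Sum>u\<in>V - ?H. d u) \<le> card (V - ?H) * 2"
    using sum_bounded_above[of "V - ?H" d 2] by fastforce
  moreover have "card (V - ?H) = card V - card ?H"
    using fin by (intro card_Diff_subset) auto
  ultimately show ?thesis using realizes_sum[OF E] by simp
qed

lemma realizes_min_vertex:
  assumes E: "realizes V d E" and "V \<noteq> {}"
  obtains v where "v \<in> V" "\<forall>u\<in>V. d v \<le> d u" "card V * d v \<le> 2 * card E"
proof -
  obtain v where v: "v \<in> V" "\<forall>u\<in>V. d v \<le> d u"
    using ex_has_least_nat[of "\<lambda>v. v \<in> V" _ d] assms(2) by blast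
  have "of_nat (card V) * d v \<le> (\<Sum>u\<in>V. d u)" by (rule sum_bounded_below) (use v in auto)
  then show ?thesis using that v realizes_sum[OF E] by simp
qed

text \<open>The graph is complete, and its six edges split into the two Hamiltonian paths
  \<open>a b c e\<close> and \<open>c a e b\<close>.\<close>

lemma packable_complete_4:
  assumes E: "realizes V d E" and V4: "card V = 4" and min: "\<forall>u\<in>V. 3 \<le> d u"
  shows "packable 0 V d"
proof -
  have s: "simple_graph V E" and fin: "finite V"
    using E realizes_finite(1)[OF E] unfolding realizes_def by auto
  have adj: "{x, y} \<in> E" if "x \<in> V" "y \<in> V" "x \<noteq> y" for x y
  proof -
    have "nbrs E x = V - {x}"
      by (rule card_seteq) (use fin nbrs_sub[OF s] that V4 realizes_card_nbrs[OF E] min in auto)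
    then show ?thesis using that unfolding nbrs_def by auto
  qed
  obtain a b c e where V: "V = {a, b, c, e}"
    and dist: "a \<noteq> b" "a \<noteq> c" "a \<noteq> e" "b \<noteq> c" "b \<noteq> e" "c \<noteq> e"
    using V4 by (auto simp: card_Suc_eq eval_nat_numeral)
  let ?C1 = "{{a, b}, {b, c}, {c, e}}" and ?C2 = "{{a, c}, {e, b}, {a, e}}"
  have conn1: "graph_connected {a} {}" by (rule graph_connectedI[of a]) auto
  have "graph_connected (insert e (insert c (insert b {a})))
      (insert {e, c} (insert {c, b} (insert {b, a} {})))"
    by (intro graph_connected_add_leaf conn1) auto
  moreover have "insert e (insert c (insert b {a})) = V"
    "insert {e, c} (insert {c, b} (insert {b, a} {})) = ?C1" unfolding V by auto
  ultimately have 1: "graph_connected V ?C1" by (simp only:)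
  have "graph_connected (insert c (insert b (insert e {a})))
      (insert {c, a} (insert {b, e} (insert {e, a} {})))"
    by (intro graph_connected_add_leaf conn1) auto
  moreover have "insert c (insert b (insert e {a})) = V"
    "insert {c, a} (insert {b, e} (insert {e, a} {})) = ?C2" unfolding V by auto
  ultimately have 2: "graph_connected V ?C2" by (simp only:)
  have "?C1 \<subseteq> E" "?C2 \<subseteq> E" using adj dist V by auto
  moreover have "?C1 \<inter> ?C2 = {}" using dist by (auto simp: doubleton_eq_iff)
  then have "card (?C1 \<inter> ?C2) \<le> 0" by (simp only: card.empty)
  ultimately show ?thesis unfolding packable_def
    by (intro exI[of _ E] exI[of _ ?C1] exI[of _ ?C2] conjI E 1 2)
qed

lemma packable_0:
  assumes "realizes V d E" "V \<noteq> {}" "\<forall>u\<in>V. 2 \<le> d u" "2 * card V \<le> card E + 2"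
  shows "packable 0 V d"
  using assms
proof (induction "card V" arbitrary: V d E rule: less_induct)
  case less
  note E = less.prems(1)
  have fin: "finite V" using realizes_finite[OF E] by simp
  obtain v where v: "v \<in> V" "\<forall>u\<in>V. d v \<le> d u" "card V * d v \<le> 2 * card E"
    using realizes_min_vertex[OF E less.prems(2)] .
  have cV: "card (V - {v}) = card V - 1" using v fin by simp
  have less_card: "d v < card V" using realizes_less_card[OF E v(1)] .
  have dv2: "2 \<le> d v" using v less.prems by auto
  then have ne: "V - {v} \<noteq> {}" using cV less_card by (intro notI) simp
  have small: "card (V - {v}) < card V" using cV less_card by simp
  \<comment> \<open>Deletion costs one vertex and \<open>d v\<close> edges, which gives the required
    edge bound. \<open>F\<close> is left open because a switch may come first.\<close>
  have del: "packable 0 V d" if F: "realizes V d F"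
    and "\<forall>u\<in>V - {v}. 2 \<le> d u - of_bool (u \<in> nbrs F v)" "2 * card V + d v \<le> card F + 4" for F
  proof (rule packable_delete_step[OF F v(1) dv2])
    have "2 * card (V - {v}) \<le> card (delete_vertex F v) + 2"
      using that(3) cV less_card card_delete_vertex_realizes[OF F v(1)] by simp
    then show "packable 0 (V - {v}) (\<lambda>u. d u - of_bool (u \<in> nbrs F v))"
      using less.hyps[OF small realizes_delete_vertex[OF F] ne] that(2) by blast
  qed
  consider "4 \<le> d v" | "d v = 3" "2 * card V \<le> card E + 1" | "d v = 3" "card E + 2 = 2 * card V"
    | "d v = 2" using dv2 less.prems(4) by linarith
  then show ?case
  proof cases
    case 1
    \<comment> \<open>With \<open>card V = k + 2\<close>,
      \<open>2 * card E \<ge> k * d v + 2 * d v \<ge> 4 * k + 2 * d v\<close>, which is twice the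
      bound that \<open>del\<close> asks for.\<close>
    obtain k where k: "card V = k + 2" using 1 less_card by (intro that[of "card V - 2"]) linarith
    have "k * 4 \<le> k * d v" using 1 by simp
    moreover have "card V * d v = k * d v + 2 * d v" unfolding k by (simp add: algebra_simps)
    ultimately have "2 * card V + d v \<le> card E + 4" using v(3) k by linarith
    moreover have "2 \<le> d u - of_bool (u \<in> nbrs E v)" if "u \<in> V - {v}" for u
    proof -
      have "4 \<le> d u" using 1 v(2) that by fastforce
      then show ?thesis by auto
    qed
    ultimately show ?thesis using del[OF E] by blast
  next
    case 2
    moreover have "2 \<le> d u - of_bool (u \<in> nbrs E v)" if "u \<in> V - {v}" for u
    proof -
      have "3 \<le> d u" using 2 v(2) that by fastforce
      then show ?thesis by auto
    qed
    ultimately show ?thesis using del[OF E] by simp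
  next
    case 3
    have min3: "\<forall>u\<in>V. 3 \<le> d u" using 3 v by auto
    show ?thesis
    proof (cases "card V = 4")
      case True
      then show ?thesis using packable_complete_4[OF E _ min3] by simp
    next
      case False
      then have V5: "5 \<le> card V" using less_card 3 by simp
      obtain c F where c: "c \<in> V - {v}" and F: "realizes (V - {v}) (d(c := d c - 1)) F"
        using realizes_pinch_exists[OF E v(1) 3(1) min3 V5] 3(2) by auto
      have dc: "3 \<le> d c" using c min3 by auto
      have "\<forall>u\<in>V - {v}. 2 \<le> (d(c := d c - 1)) u" using dc less.prems(3) by auto
      then show ?thesis
        using packable_pinch_step[OF E v(1) 3(1) c _ F, of 0] less.hyps[OF small F ne] dc V5 3(2)
        by simp
    qed
  next
    case 4
    let ?H = "{u \<in> V. 3 \<le> d u}"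
    \<comment> \<open>With at most one vertex of degree above two, the degree sum is at most
      \<open>3 * (card V - 1)\<close>, or \<open>2 * card V\<close> if there is none; both are less
      than \<open>4 * (card V - 1)\<close>.\<close>
    have cH: "2 \<le> card ?H"
    proof (rule ccontr)
      assume "\<not> 2 \<le> card ?H"
      then have "card ?H = 0 \<or> card ?H = 1" by linarith
      then show False
        using realizes_sum_le_high_degrees[OF E] less.prems(4) less_card 4 by auto
    qed
    obtain F where F: "realizes V d F" "nbrs F v \<subseteq> ?H \<or> ?H \<subseteq> nbrs F v"
      using realizes_switch_threshold[OF E v(1), of 3] 4 by auto
    have cN: "card (nbrs F v) = 2" using realizes_card_nbrs[OF F(1) v(1)] 4 by simp
    then have finN: "finite (nbrs F v)" using card.infinite by fastforce
    \<comment> \<open>If the switch ends with \<open>?H\<close> inside the two-element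
      neighbourhood, the sets coincide. So both neighbours can afford to lose
      \<open>v\<close>.\<close>
    have sub: "nbrs F v \<subseteq> ?H" using F(2) card_seteq[OF finN, of ?H] cN cH by auto
    have "2 \<le> d u - of_bool (u \<in> nbrs F v)" if "u \<in> V - {v}" for u
      using sub less.prems(3) that by auto
    moreover have "card F = card E" using realizes_sum[OF F(1)] realizes_sum[OF E] by simp
    ultimately show ?thesis using del[OF F(1)] less.prems(4) 4 by simp
  qed
qed

text \<open>The last premise is the order-free form of the conditions on \<open>d_(n-1)\<close> and
  \<open>d_n\<close>. It must be reproduced after each deletion of a vertex of degree two and each
  pinch; the other cases pass to \<open>packable_0\<close>.\<close>

lemma packable_1:
  assumes "realizes V d E" "V \<noteq> {}" "2 * card V \<le> card E + 3"
    "card V \<le> 2 \<or> (\<forall>u\<in>V. 1 \<le> d u) \<and> (\<forall>u\<in>V. \<forall>w\<in>V. d u \<le> 1 \<longrightarrow> d w \<le> 1 \<longrightarrow> u = w)"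
  shows "packable 1 V d"
  using assms
proof (induction "card V" arbitrary: V d E rule: less_induct)
  case less
  note E = less.prems(1)
  have fin: "finite V" using realizes_finite[OF E] by simp
  have s: "simple_graph V E" using E unfolding realizes_def by simp
  have pos: "card V > 0" using fin less.prems(2) card_gt_0_iff by blast
  then consider "card V = 1" | "card V = 2" | "3 \<le> card V" by linarith
  then show ?case
  proof cases
    case 1
    then obtain x where "V = {x}" by (auto simp: card_1_singleton_iff)
    then have "graph_connected V {}" by (intro graph_connectedI[of x]) auto
    then show ?thesis unfolding packable_def
      by (intro exI[of _ E] exI[of _ "{}"] conjI E) auto
  next
    case 2
    then have "E \<noteq> {}" using less.prems(3) by auto
    then obtain e where e: "e \<in> E" by auto
    then obtain x y where xy: "e = {x, y}" "x \<noteq> y" "x \<in> V" "y \<in> V"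
      using simple_graph_edgeE[OF s] by blast
    have "{x, y} = V" by (rule card_seteq) (use fin xy 2 in auto)
    then have V: "V = insert x {y}" by simp
    have "graph_connected {y} {}" by (rule graph_connectedI[of y]) auto
    then have conn: "graph_connected V {e}"
      unfolding V xy(1) by (rule graph_connected_add_leaf) simp
    \<comment> \<open>The single edge serves as both subgraphs and is the one shared edge.\<close>
    show ?thesis unfolding packable_def
      by (intro exI[of _ E] exI[of _ "{e}"] conjI E conn) (use e in auto)
  next
    case 3
    then have d1: "\<forall>u\<in>V. 1 \<le> d u" and uniq: "\<And>u w. u \<in> V \<Longrightarrow> w \<in> V \<Longrightarrow> d u \<le> 1 \<Longrightarrow> d w \<le> 1 \<Longrightarrow> u = w"
      using less.prems(4) by auto
    obtain v where v: "v \<in> V" "\<forall>u\<in>V. d v \<le> d u" "card V * d v \<le> 2 * card E"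
      using realizes_min_vertex[OF E less.prems(2)] .
    have cV: "card (V - {v}) = card V - 1" using v fin by simp
    then have "card (V - {v}) \<noteq> 0" using 3 by linarith
    then have ne: "V - {v} \<noteq> {}" by (metis card.empty)
    have small: "card (V - {v}) < card V" using cV 3 by simp
    have d2: "2 \<le> d u" if "u \<in> V - {v}" for u
      using that uniq[of u v] v by fastforce
    let ?H = "{u \<in> V. 3 \<le> d u}"
    have sw: "\<exists>F a. realizes V d F \<and> card F = card E \<and> a \<in> nbrs F v \<and> 3 \<le> d a"
      if "d v < 3" "?H \<noteq> {}"
    proof -
      obtain F where F: "realizes V d F" "nbrs F v \<subseteq> ?H \<or> ?H \<subseteq> nbrs F v"
        using realizes_switch_threshold[OF E v(1) \<open>d v < 3\<close>] .
      have "card (nbrs F v) > 0" using realizes_card_nbrs[OF F(1) v(1)] d1 v(1) by fastforce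
      then have "nbrs F v \<noteq> {}" by auto
      moreover have "card F = card E" using realizes_sum[OF F(1)] realizes_sum[OF E] by simp
      ultimately show ?thesis using F that(2) by blast
    qed
    consider "d v = 1" | "d v = 2" | "3 \<le> d v" "2 * card V \<le> card E + 2"
      | "3 \<le> d v" "2 * card V = card E + 3"
      using d1 v(1) less.prems(3) by force
    then show ?thesis
    proof cases
      case 1
      \<comment> \<open>Otherwise the degree sum is at most \<open>2 * card V - 1\<close>, below
        \<open>4 * card V - 6\<close> from three vertices on.\<close>
      have "?H \<noteq> {}"
      proof
        assume "?H = {}"
        then have "(\<Sum>u\<in>V - {v}. d u) \<le> of_nat (card (V - {v})) * 2"
          by (intro sum_bounded_above) force
        moreover have "(\<Sum>u\<in>V. d u) = d v + (\<Sum>u\<in>V - {v}. d u)" using v fin by (simp add: sum.remove)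
        ultimately show False using realizes_sum[OF E] 1 cV less.prems(3) 3 by simp
      qed
      then obtain F a where F: "realizes V d F" "card F = card E" "a \<in> nbrs F v" "3 \<le> d a"
        using sw 1 by auto
      have "nbrs F v = {a}" using realizes_card_nbrs[OF F(1) v(1)] 1 F(3)
        by (auto simp: card_1_singleton_iff)
      then have "\<forall>u\<in>V - {v}. 2 \<le> d u - of_bool (u \<in> nbrs F v)" using d2 F(4) by auto
      moreover have "2 * card (V - {v}) \<le> card (delete_vertex F v) + 2"
        using card_delete_vertex_realizes[OF F(1) v(1)] 1 F(2) cV less.prems(3) by simp
      \<comment> \<open>The rest is packed without sharing; the pendant edge at \<open>v\<close>,
        used twice, is the shared one.\<close>
      ultimately have "packable 0 (V - {v}) (\<lambda>u. d u - of_bool (u \<in> nbrs F v))"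
        using packable_0[OF realizes_delete_vertex[OF F(1)] ne] by blast
      then show ?thesis using packable_if_delete_vertex[OF F(1) v(1) F(3) F(3)] by fastforce
    next
      case 2
      \<comment> \<open>The restriction leaves out the triangle, which meets the edge bound with all
        degrees two. There \<open>V - {v}\<close> has only two vertices and no degree condition is
        left to check.\<close>
      have cH: "?H \<noteq> {}" if "4 \<le> card V"
      proof
        assume "?H = {}"
        then have "card ?H = 0" by (simp only: card.empty)
        then show False using realizes_sum_le_high_degrees[OF E] less.prems(3) that by simp
      qed
      obtain F where F: "realizes V d F" "card F = card E"
        "4 \<le> card V \<Longrightarrow> \<exists>a. a \<in> nbrs F v \<and> 3 \<le> d a"
        using sw cH 2 E by (cases "4 \<le> card V") auto
      let ?d = "\<lambda>u. d u - of_bool (u \<in> nbrs F v)"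
      have d1': "\<forall>u\<in>V - {v}. 1 \<le> ?d u"
      proof
        fix u assume "u \<in> V - {v}"
        then show "1 \<le> ?d u" using d2[of u] by (cases "u \<in> nbrs F v") auto
      qed
      have cN: "card (nbrs F v) = 2" using realizes_card_nbrs[OF F(1) v(1)] 2 by simp
      have "u = w" if "4 \<le> card V" "u \<in> V - {v}" "w \<in> V - {v}" "?d u \<le> 1" "?d w \<le> 1" for u w
      proof -
        obtain a where a: "a \<in> nbrs F v" "3 \<le> d a" using F(3) \<open>4 \<le> card V\<close> by blast
        then obtain b where b: "nbrs F v = {a, b}"
          using cN unfolding card_2_iff by (metis insert_commute insertE singletonD)
        \<comment> \<open>Only the neighbours of \<open>v\<close> lose degree, and \<open>a\<close>
          keeps at least two, so \<open>b\<close> alone can drop to one.\<close>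
        have "x = b" if "x \<in> V - {v}" "?d x \<le> 1" for x
          using that d2[OF that(1)] a(2) unfolding b by (cases "x = a"; cases "x = b") auto
        then show ?thesis using that by metis
      qed
      then have cond: "card (V - {v}) \<le> 2 \<or> (\<forall>u\<in>V - {v}. 1 \<le> ?d u) \<and>
          (\<forall>u\<in>V - {v}. \<forall>w\<in>V - {v}. ?d u \<le> 1 \<longrightarrow> ?d w \<le> 1 \<longrightarrow> u = w)"
        using d1' cV by (cases "4 \<le> card V") auto
      have "2 * card (V - {v}) \<le> card (delete_vertex F v) + 3"
        using card_delete_vertex_realizes[OF F(1) v(1)] 2 F(2) cV less.prems(3) by simp
      then have "packable 1 (V - {v}) ?d"
        using less.hyps[OF small realizes_delete_vertex[OF F(1)] ne _ cond] by blast
      then show ?thesis using packable_delete_step[OF F(1) v(1)] 2 by simp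
    next
      case 3
      then have "\<forall>u\<in>V. 2 \<le> d u" using v by auto
      then have "packable 0 V d" using packable_0[OF E less.prems(2)] 3 by blast
      then show ?thesis using packable_mono by fastforce
    next
      case 4
      \<comment> \<open>The degree sum is \<open>4 * card V - 6\<close>, so the average lies below
        four. Minimum degree three then gives at least six vertices, so
        \<open>realizes_pinch_exists\<close> applies.\<close>
      have dv3: "d v = 3"
      proof (rule ccontr)
        assume "d v \<noteq> 3"
        then have "card V * 4 \<le> card V * d v" using 4 by simp
        then show False using v(3) 4(2) by linarith
      qed
      have V5: "5 \<le> card V" using v(3) 4(2) dv3 by simp
      have min3: "\<forall>u\<in>V. 3 \<le> d u" using dv3 v by auto
      obtain c F where c: "c \<in> V - {v}" and F: "realizes (V - {v}) (d(c := d c - 1)) F"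
        using realizes_pinch_exists[OF E v(1) dv3 min3 V5] 4(2) by auto
      have dc: "3 \<le> d c" using c min3 by auto
      have "2 \<le> (d(c := d c - 1)) u" if "u \<in> V - {v}" for u using dc d2[OF that] by auto
      then have cond: "card (V - {v}) \<le> 2 \<or> (\<forall>u\<in>V - {v}. 1 \<le> (d(c := d c - 1)) u) \<and>
          (\<forall>u\<in>V - {v}. \<forall>w\<in>V - {v}. (d(c := d c - 1)) u \<le> 1 \<longrightarrow> (d(c := d c - 1)) w \<le> 1 \<longrightarrow> u = w)"
        by fastforce
      have "packable 1 (V - {v}) (d(c := d c - 1))" if "2 * card (V - {v}) \<le> card F + 3"
        by (rule less.hyps[OF small F ne that]) (rule cond)
      then show ?thesis
        by (intro packable_pinch_step[OF E v(1) dv3 c _ F]) (use dc V5 4(2) in simp_all)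
    qed
  qed
qed

subsection \<open>The characterization\<close>

lemma packable_spanning_trees:
  assumes "packable k V d"
  obtains E T1 T2 where "realizes V d E" "spanning_tree V E T1" "spanning_tree V E T2"
    "card (T1 \<inter> T2) \<le> k"
proof -
  obtain E C1 C2 where E: "realizes V d E" and C: "C1 \<subseteq> E" "C2 \<subseteq> E"
    "graph_connected V C1" "graph_connected V C2" "card (C1 \<inter> C2) \<le> k"
    using assms unfolding packable_def by blast
  have s: "simple_graph V E" using E unfolding realizes_def by simp
  obtain T1 where T1: "spanning_tree V C1 T1"
    using graph_connected_has_spanning_tree[OF simple_graph_subset[OF s C(1)] C(3)] .
  obtain T2 where T2: "spanning_tree V C2 T2"
    using graph_connected_has_spanning_tree[OF simple_graph_subset[OF s C(2)] C(4)] .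
  have "spanning_tree V E T1" "spanning_tree V E T2"
    using T1 T2 C unfolding spanning_tree_def by auto
  moreover have "finite C1" using C(1) realizes_finite(2)[OF E] finite_subset by blast
  then have "card (T1 \<inter> T2) \<le> card (C1 \<inter> C2)"
    using T1 T2 unfolding spanning_tree_def by (intro card_mono) auto
  then have "card (T1 \<inter> T2) \<le> k" using C(5) by simp
  ultimately show ?thesis using that E by blast
qed

section \<open>Necessity: edge count and pendant vertices\<close>

lemma two_connected_subgraphs_card_le:
  assumes s: "simple_graph V E" and T: "T1 \<subseteq> E" "T2 \<subseteq> E" "graph_connected V T1" "graph_connected V T2"
  shows "2 * card V \<le> card E + 2 + card (T1 \<inter> T2)"
proof -
  have fin: "finite E" "finite T1" "finite T2"
    using simple_graph_finite[OF s] T finite_subset by blast+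
  have "card V \<le> card T1 + 1" "card V \<le> card T2 + 1"
    using graph_connected_card_le[OF simple_graph_subset[OF s]] T by blast+
  moreover have "card (T1 \<union> T2) + card (T1 \<inter> T2) = card T1 + card T2"
    using card_Un_Int[OF fin(2,3)] by simp
  moreover have "card (T1 \<union> T2) \<le> card E" using T fin by (intro card_mono) auto
  ultimately show ?thesis by linarith
qed

lemma graph_connected_edge_at:
  assumes "graph_connected V T" "u \<in> V" "w \<in> V" "u \<noteq> w"
  obtains e where "e \<in> T" "u \<in> e"
  using graph_connected_crossing_edge[OF assms(1,2), of "{u}" w] assms(3,4) by blast

lemma graph_connected_degree_pos:
  assumes "simple_graph V E" "T \<subseteq> E" "graph_connected V T" "u \<in> V" "2 \<le> card V"
  shows "1 \<le> degree E u"
proof -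
  have "V \<noteq> {u}" using assms(5) by auto
  then obtain w where "w \<in> V" "u \<noteq> w" using assms(4) by blast
  then obtain e where "e \<in> T" "u \<in> e" using graph_connected_edge_at[OF assms(3,4)] by metis
  then have "{e \<in> E. u \<in> e} \<noteq> {}" using assms(2) by auto
  then show ?thesis
    using simple_graph_finite[OF assms(1)] unfolding degree_def
    by (simp add: Suc_le_eq card_gt_0_iff)
qed

text \<open>Each subgraph must reach \<open>u\<close>, and there is only one edge to do it
  with.\<close>

lemma pendant_edge_shared:
  assumes s: "simple_graph V E" and T: "T1 \<subseteq> E" "T2 \<subseteq> E" "graph_connected V T1" "graph_connected V T2"
    and u: "u \<in> V" "w \<in> V" "u \<noteq> w" "degree E u \<le> 1"
  obtains e where "e \<in> T1 \<inter> T2" "\<And>f. f \<in> E \<Longrightarrow> u \<in> f \<Longrightarrow> f = e"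
proof -
  obtain e1 where e1: "e1 \<in> T1" "u \<in> e1" using graph_connected_edge_at[OF T(3) u(1-3)] .
  obtain e2 where e2: "e2 \<in> T2" "u \<in> e2" using graph_connected_edge_at[OF T(4) u(1-3)] .
  have fin: "finite {e \<in> E. u \<in> e}" using simple_graph_finite[OF s] by simp
  have one: "f = g" if "f \<in> E" "u \<in> f" "g \<in> E" "u \<in> g" for f g
    using u(4) card_le_Suc0_iff_eq[OF fin] that unfolding degree_def by simp
  then have "e1 = e2" using e1 e2 T by blast
  then show ?thesis using that[of e1] one e1 e2 T(1) by blast
qed

text \<open>Two pendant vertices would each force a shared edge. With one shared edge in all, it
  joins them and cuts both off from a third vertex.\<close>

lemma two_pendant_vertices_eq:
  assumes s: "simple_graph V E" and T: "T1 \<subseteq> E" "T2 \<subseteq> E" "graph_connected V T1" "graph_connected V T2"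
    and one: "card (T1 \<inter> T2) \<le> 1" and V3: "3 \<le> card V"
    and u: "u \<in> V" "degree E u \<le> 1" and w: "w \<in> V" "degree E w \<le> 1"
  shows "u = w"
proof (rule ccontr)
  assume uw: "u \<noteq> w"
  obtain e where e: "e \<in> T1 \<inter> T2" "\<And>f. f \<in> E \<Longrightarrow> u \<in> f \<Longrightarrow> f = e"
    using pendant_edge_shared[OF s T u(1) w(1) uw u(2)] by blast
  obtain f where f: "f \<in> T1 \<inter> T2" "\<And>g. g \<in> E \<Longrightarrow> w \<in> g \<Longrightarrow> g = f"
    using pendant_edge_shared[OF s T w(1) u(1) uw[symmetric] w(2)] by blast
  have fin: "finite (T1 \<inter> T2)" using simple_graph_finite[OF s] T finite_subset by blast
  have "e = f" using one card_le_Suc0_iff_eq[OF fin] e(1) f(1) by simp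
  have "card {u, w} \<le> 2" by (simp add: card_insert_if)
  then have "\<not> V \<subseteq> {u, w}" using V3 card_mono[of "{u, w}" V] by auto
  then obtain z where z: "z \<in> V" "z \<notin> {u, w}" by auto
  \<comment> \<open>An edge of \<open>T1\<close> leaving \<open>{u, w}\<close> must be
    \<open>e\<close>, but \<open>e\<close> contains both \<open>u\<close> and \<open>w\<close>,
    which leaves no room for \<open>y\<close>.\<close>
  obtain x y where xy: "x \<in> {u, w}" "y \<notin> {u, w}" "{x, y} \<in> T1"
    using graph_connected_crossing_edge[OF T(3) u(1), of "{u, w}" z] z by blast
  then have "{x, y} = e" using e(2) f(2) \<open>e = f\<close> T(1) by blast
  moreover obtain u' where "{u, u'} \<in> T1"
    using graph_connected_crossing_edge[OF T(3) u(1), of "{u}" w] uw w(1) by blast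
  then have "u \<in> e" using e(2)[of "{u, u'}"] T(1) by auto
  moreover obtain w' where "{w, w'} \<in> T1"
    using graph_connected_crossing_edge[OF T(3) w(1), of "{w}" u] uw u(1) by blast
  then have "w \<in> e" using f(2)[of "{w, w'}"] T(1) \<open>e = f\<close> by auto
  ultimately show False using xy uw by auto
qed

theorem theorem3p1:
  fixes n :: nat and d :: "nat \<Rightarrow> nat"
  assumes "n \<ge> 1" and "graphical n d"
  shows "(\<exists>E T1 T2. realization n d E \<and> spanning_tree {1..n} E T1 \<and>
            spanning_tree {1..n} E T2 \<and> card (T1 \<inter> T2) \<le> 1) \<longleftrightarrow>
         (int (\<Sum>i=1..n. d i) \<ge> 4 * (int n - 1) - 2 \<and>
          (n \<le> 2 \<or> (n > 2 \<and> d (n - 1) \<ge> 2 \<and> d n \<ge> 1)))"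
    (is "?L \<longleftrightarrow> ?R")
proof
  have real: "realization n d E \<longleftrightarrow> realizes {1..n} d E" for E
    unfolding realization_def realizes_def ..
  have mono: "d j \<le> d i" if "1 \<le> i" "i \<le> j" "j \<le> n" for i j
    using assms(2) that unfolding graphical_def degree_sequence_def by auto
  {
    assume ?L
    then obtain E T1 T2 where E: "realizes {1..n} d E" and T: "T1 \<subseteq> E" "T2 \<subseteq> E"
      "graph_connected {1..n} T1" "graph_connected {1..n} T2" and one: "card (T1 \<inter> T2) \<le> 1"
      unfolding real spanning_tree_def is_tree_def by blast
    have s: "simple_graph {1..n} E" and dE: "\<And>i. i \<in> {1..n} \<Longrightarrow> degree E i = d i"
      using E unfolding realizes_def by auto
    have "2 * n \<le> card E + 3"
      using two_connected_subgraphs_card_le[OF s T] one by simp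
    then have "int (\<Sum>i=1..n. d i) \<ge> 4 * (int n - 1) - 2"
      unfolding realizes_sum[OF E] by simp
    moreover have "d n \<ge> 1" "d (n - 1) \<ge> 2" if "n > 2"
    proof -
      show "d n \<ge> 1" using graph_connected_degree_pos[OF s T(1,3), of n] dE[of n] that by simp
      show "d (n - 1) \<ge> 2"
      proof (rule ccontr)
        assume small: "\<not> d (n - 1) \<ge> 2"
        moreover have "d n \<le> d (n - 1)" using mono[of "n - 1" n] that by simp
        ultimately have "degree E (n - 1) \<le> 1" "degree E n \<le> 1"
          using dE[of n] dE[of "n - 1"] that by auto
        then have "n - 1 = n"
          using two_pendant_vertices_eq[OF s T one, of "n - 1" n] that by simp
        then show False using that by simp
      qed
    qed
    ultimately show ?R by force
  }
  {
    assume R: ?R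
    obtain E where E: "realizes {1..n} d E" using assms(2) real unfolding graphical_def by blast
    have many: "2 * card {1..n} \<le> card E + 3" using R unfolding realizes_sum[OF E] by simp
    have "u = w" if "2 < n" "u \<in> {1..n}" "w \<in> {1..n}" "d u \<le> 1" "d w \<le> 1" for u w
    proof -
      \<comment> \<open>The degrees are sorted and \<open>d (n - 1) \<ge> 2\<close>, so an entry of
        at most one can only be the last.\<close>
      have "x = n" if "x \<in> {1..n}" "d x \<le> 1" for x
        using mono[of x "n - 1"] that R \<open>2 < n\<close> by force
      then show ?thesis using that by metis
    qed
    moreover have "1 \<le> d u" if "2 < n" "u \<in> {1..n}" for u
      using mono[of u n] that R by force
    ultimately have "packable 1 {1..n} d"
      using packable_1[OF E _ many] assms(1) by (cases "n \<le> 2") auto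
    then show ?L using packable_spanning_trees real by metis
  }
qed

end
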